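(* Let $G$ be an undirected graph and let $t$ be a real number. If $\chi_f(G)\ge t$, then $$\vec{\chi}_f(G) \ge \frac{t}{4\log_2(2et^2)},$$ where $e$ is the base of the natural logarithm.
   Context: For an undirected graph $G$, $\mathcal{I}(G)$ is the family of all independent vertex-sets of $G$. The fractional chromatic number $\chi_f(G)$ is the minimum of $\sum_{I\in\mathcal{I}(G)}x_I$ over nonnegative reals $(x_I)_{I\in\mathcal{I}(G)}$ satisfying $\sum_{I\in\mathcal{I}(G),\, v\in I}x_I\ge 1$ for every vertex $v$. For a digraph $D$, a vertex-set is acyclic if it does not contain a directed cycle (that is, the subdigraph it induces has no directed cycle). The fractional chromatic number $\chi_f(D)$ of $D$ is defined by the same linear program with the family of acyclic vertex-sets of $D$ in place of $\mathcal{I}(G)$. An orientation of $G$ is a digraph obtained by choosing exactly one direction for each edge of $G$. The fractional dichromatic number $\vec{\chi}_f(G)$ is the maximum of $\chi_f(D)$ over all orientations $D$ of $G$.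
   Formalization: The formal statement assumes |t| ≥ 1/2: the bound is undefined at t = 0 and t = ±1/√(2e), and false nearby (e.g. t = 0.43 for a one-vertex graph, where the right side is about 14); every t ≥ 1 is covered. *)

theory Defs
  imports "Graph_Theory.Graph_Theory" "HOL-Analysis.Analysis"
begin

text \<open>
  Finite simple undirected graphs are the library's \<^locale>\<open>pair_graph\<close>: an edge between
  \<open>u\<close> and \<open>v\<close> is the pair of opposite arcs \<open>(u, v)\<close>, \<open>(v, u)\<close>.
\<close>

subsection \<open>Fractional covers\<close>

definition fractional_cover :: "'a set \<Rightarrow> 'a set set \<Rightarrow> ('a set \<Rightarrow> real) \<Rightarrow> bool" where
  "fractional_cover V F x \<longleftrightarrow>
     (\<forall>I\<in>F. 0 \<le> x I) \<and> (\<forall>v\<in>V. 1 \<le> (\<Sum>I | I \<in> F \<and> v \<in> I. x I))"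

text \<open>
  The optimum of the covering program. The infimum is a minimum whenever \<open>F\<close> is finite and
  covers \<open>V\<close>; see \<open>fractional_cover_number_attained\<close> below.
\<close>

definition fractional_cover_number :: "'a set \<Rightarrow> 'a set set \<Rightarrow> real" where
  "fractional_cover_number V F = Inf {(\<Sum>I\<in>F. x I) | x. fractional_cover V F x}"

subsection \<open>Chromatic and dichromatic numbers\<close>

definition independent_sets :: "'a pair_pre_digraph \<Rightarrow> 'a set set" where
  "independent_sets G = {I. I \<subseteq> pverts G \<and> (\<forall>u\<in>I. \<forall>v\<in>I. (u, v) \<notin> parcs G)}"

definition fractional_chromatic_number :: "'a pair_pre_digraph \<Rightarrow> real" where
  "fractional_chromatic_number G = fractional_cover_number (pverts G) (independent_sets G)"

definition acyclic_sets :: "'a pair_pre_digraph \<Rightarrow> 'a set set" where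
  "acyclic_sets D = {S. S \<subseteq> pverts D \<and> \<not> (\<exists>p. pre_digraph.cycle (with_proj D \<restriction> S) p)}"

definition digraph_fractional_chromatic_number :: "'a pair_pre_digraph \<Rightarrow> real" where
  "digraph_fractional_chromatic_number D = fractional_cover_number (pverts D) (acyclic_sets D)"

definition orientations :: "'a pair_pre_digraph \<Rightarrow> 'a pair_pre_digraph set" where
  "orientations G = {D. pverts D = pverts G \<and> parcs D \<subseteq> parcs G \<and>
     (\<forall>(u, v)\<in>parcs G. (u, v) \<in> parcs D \<longleftrightarrow> (v, u) \<notin> parcs D)}"

definition fractional_dichromatic_number :: "'a pair_pre_digraph \<Rightarrow> real" where
  "fractional_dichromatic_number G = Max (digraph_fractional_chromatic_number ` orientations G)"

subsection \<open>The optima above exist\<close>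

lemma finite_orientations:
  assumes "pair_graph G"
  shows "finite (orientations G)"
proof -
  interpret pair_graph G by fact
  have "orientations G \<subseteq> (\<lambda>A. \<lparr>pverts = pverts G, parcs = A\<rparr>) ` Pow (parcs G)"
  proof
    fix D assume "D \<in> orientations G"
    then have "D = \<lparr>pverts = pverts G, parcs = parcs D\<rparr>" "parcs D \<in> Pow (parcs G)"
      by (auto simp: orientations_def)
    then show "D \<in> (\<lambda>A. \<lparr>pverts = pverts G, parcs = A\<rparr>) ` Pow (parcs G)" by blast
  qed
  then show ?thesis using pair_finite_arcs by (auto intro: finite_subset)
qed

lemma orientations_nonempty:
  assumes "pair_graph G"
  shows "orientations G \<noteq> {}"
proof -
  interpret pair_graph G by fact
  obtain f :: "'a \<Rightarrow> nat" where f: "inj_on f (pverts G)"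
    using finite_imp_inj_to_nat_seg[OF pair_finite_verts] by blast
  let ?D = "\<lparr>pverts = pverts G, parcs = {(u, v) \<in> parcs G. f u < f v}\<rparr>"
  have "(u, v) \<in> parcs ?D \<longleftrightarrow> (v, u) \<notin> parcs ?D" if uv: "(u, v) \<in> parcs G" for u v
  proof -
    have "(v, u) \<in> parcs G"
      using uv pair_sym_arcs by (auto simp: symmetric_def sym_def)
    moreover have "f u \<noteq> f v"
      using f uv no_loops'[OF uv] in_arcsD1[OF uv] in_arcsD2[OF uv] by (auto dest: inj_onD)
    ultimately show ?thesis using uv by auto
  qed
  then have "?D \<in> orientations G" by (auto simp: orientations_def)
  then show ?thesis by blast
qed

lemma finite_independent_sets: "finite (pverts G) \<Longrightarrow> finite (independent_sets G)"
  by (rule finite_subset[of _ "Pow (pverts G)"]) (auto simp: independent_sets_def)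

lemma finite_acyclic_sets: "finite (pverts D) \<Longrightarrow> finite (acyclic_sets D)"
  by (rule finite_subset[of _ "Pow (pverts D)"]) (auto simp: acyclic_sets_def)

lemma independent_sets_cover:
  assumes "pair_graph G"
  shows "pverts G \<subseteq> \<Union> (independent_sets G)"
proof
  interpret pair_graph G by fact
  fix v assume "v \<in> pverts G"
  then have "{v} \<in> independent_sets G"
    using no_loops' by (auto simp: independent_sets_def)
  then show "v \<in> \<Union> (independent_sets G)" by blast
qed

lemma acyclic_sets_cover:
  assumes "pair_graph G" "D \<in> orientations G"
  shows "pverts D \<subseteq> \<Union> (acyclic_sets D)"
proof
  interpret pair_graph G by fact
  fix v assume v: "v \<in> pverts D"
  have "(v, v) \<notin> parcs D" using assms(2) no_loops' by (auto simp: orientations_def)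
  then have "arcs (with_proj D \<restriction> {v}) = {}" by (auto simp: induce_subgraph_def)
  then have "\<not> pre_digraph.cycle (with_proj D \<restriction> {v}) p" for p
    by (metis pre_digraph.cycle_def pre_digraph.awalk_def subset_empty set_empty)
  then have "{v} \<in> acyclic_sets D" using v by (auto simp: acyclic_sets_def)
  then show "v \<in> \<Union> (acyclic_sets D)" by blast
qed

lemma fractional_cover_number_attained:
  assumes F: "finite F" and cov: "V \<subseteq> \<Union> F"
  shows "\<exists>x. fractional_cover V F x \<and> (\<Sum>I\<in>F. x I) = fractional_cover_number V F \<and>
           (\<forall>y. fractional_cover V F y \<longrightarrow> (\<Sum>I\<in>F. x I) \<le> (\<Sum>I\<in>F. y I))"
proof -
  define K :: "('a set \<Rightarrow> real) set" where "K = (\<Pi>\<^sub>E I\<in>UNIV. if I \<in> F then {0..1} else {0})"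
  define C where "C = K \<inter> {x. \<forall>v\<in>V. 1 \<le> (\<Sum>I | I \<in> F \<and> v \<in> I. x I)}"
  have coord: "continuous_on UNIV (\<lambda>x :: 'a set \<Rightarrow> real. x I)" for I
    by (rule continuous_on_product_coordinates)
  have "compactin (product_topology (\<lambda>_. euclidean) UNIV) K"
    unfolding K_def by (subst compactin_PiE) auto
  then have "compact K" by (simp only: euclidean_product_topology compactin_euclidean_iff)
  moreover have "closed {x :: 'a set \<Rightarrow> real. \<forall>v\<in>V. 1 \<le> (\<Sum>I | I \<in> F \<and> v \<in> I. x I)}"
    unfolding Collect_ball_eq
    by (intro closed_INT ballI closed_Collect_le continuous_on_sum coord continuous_on_const)
  ultimately have "compact C" unfolding C_def by (rule compact_Int_closed)
  have clip: "(\<lambda>I. if I \<in> F then min (y I) 1 else 0) \<in> C" if y: "fractional_cover V F y" for y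
  proof -
    have "1 \<le> (\<Sum>I | I \<in> F \<and> v \<in> I. if I \<in> F then min (y I) 1 else 0)" if v: "v \<in> V" for v
    proof (cases "\<exists>J\<in>F. v \<in> J \<and> 1 \<le> y J")
      case True
      then obtain J where J: "J \<in> F" "v \<in> J" "1 \<le> y J" by blast
      have "(if J \<in> F then min (y J) 1 else 0) \<le> (\<Sum>I | I \<in> F \<and> v \<in> I. if I \<in> F then min (y I) 1 else 0)"
        using J F y by (intro member_le_sum) (auto simp: fractional_cover_def)
      then show ?thesis using J by simp
    next
      case False
      then have "(\<Sum>I | I \<in> F \<and> v \<in> I. if I \<in> F then min (y I) 1 else 0) = (\<Sum>I | I \<in> F \<and> v \<in> I. y I)"
        by (intro sum.cong) auto
      then show ?thesis using y v by (auto simp: fractional_cover_def)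
    qed
    then show ?thesis using y by (auto simp: C_def K_def fractional_cover_def)
  qed
  have "1 \<le> (\<Sum>I | I \<in> F \<and> v \<in> I. 1 :: real)" if "v \<in> V" for v
  proof -
    have "{I. I \<in> F \<and> v \<in> I} \<noteq> {}" "finite {I. I \<in> F \<and> v \<in> I}" using cov F that by auto
    then have "1 \<le> card {I. I \<in> F \<and> v \<in> I}" using card_gt_0_iff by (metis One_nat_def Suc_leI)
    then show ?thesis by simp
  qed
  then have "fractional_cover V F (\<lambda>_. 1)" by (simp add: fractional_cover_def)
  then have "C \<noteq> {}" using clip by blast
  moreover have "continuous_on C (\<lambda>x. \<Sum>I\<in>F. x I)"
    by (intro continuous_on_sum continuous_on_subset[OF coord]) auto
  ultimately obtain x where x: "x \<in> C" and min: "\<And>y. y \<in> C \<Longrightarrow> (\<Sum>I\<in>F. x I) \<le> (\<Sum>I\<in>F. y I)"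
    using continuous_attains_inf[OF \<open>compact C\<close>] by blast
  have x0: "0 \<le> x I" if "I \<in> F" for I
  proof -
    have "x I \<in> (if I \<in> F then {0..1} else {0})"
      using x unfolding C_def K_def by (blast dest: PiE_mem)
    then show ?thesis using that by simp
  qed
  have cx: "fractional_cover V F x"
    using x x0 by (auto simp: C_def fractional_cover_def)
  have le: "(\<Sum>I\<in>F. x I) \<le> (\<Sum>I\<in>F. y I)" if "fractional_cover V F y" for y
  proof -
    have "(\<Sum>I\<in>F. x I) \<le> (\<Sum>I\<in>F. if I \<in> F then min (y I) 1 else 0)"
      using min[OF clip[OF that]] .
    also have "\<dots> \<le> (\<Sum>I\<in>F. y I)" by (intro sum_mono) auto
    finally show ?thesis .
  qed
  have "fractional_cover_number V F = (\<Sum>I\<in>F. x I)"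
    unfolding fractional_cover_number_def using cx le by (intro cInf_eq_minimum) auto
  then show ?thesis using cx le by auto
qed

end

theory Submission
  imports Defs
begin

text \<open>
Let \<open>L = log\<^sub>2(2et\<^sup>2)\<close>. By linear programming duality there is a probability weighting \<open>w\<close> of the
vertices in which independent sets weigh at most about \<open>1 / t\<close> (\<open>fractional_cover_dual\<close>). It
suffices to find one orientation in which acyclic sets weigh at most \<open>4L / t\<close>, because then \<open>w\<close>
certifies that its fractional chromatic number is at least \<open>t / (4L)\<close>
(\<open>fractional_cover_number_ge_weight\<close>). A random orientation has this property with positive
probability.

If all weights are equal, this is a union bound. A set in which all degrees are at
least \<open>d\<close> is acyclic with probability at most \<open>((d + 1) 2\<^bsup>-d / 2\<^esup>)\<^bsup>r\<^esup>\<close>, where \<open>r\<close> is its size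
(\<open>card_orientations_of_acyclic_on_le_min_degree\<close>), because a graph has at most
\<open>\<Prod>(deg v + 1)\<close> acyclic orientations. This beats the number of
sets that contain a fraction \<open>\<beta>\<close> of all vertices as soon as \<open>d\<close> is about \<open>2L\<close> and \<open>\<beta>\<close> is of
order \<open>L / t\<close>. A set without dense subsets of this size becomes \<open>d\<close>-colourable, and hence of
weight at most \<open>d / t\<close>, after the removal of a fraction \<open>\<beta>\<close> of the vertices.

For unequal weights the size of a set must be measured at the right scale. A set is called
top-heavy if it contains more than the fraction \<open>\<beta>\<close> of the vertices at least as heavy as its
lightest member. All top-heavy sets of size \<open>r\<close> lie in one common set of fewer than \<open>r / \<beta>\<close>
vertices, so the union bound remains valid, uniformly in the number of vertices and of weight scales
(\<open>sum_top_heavy_less_one\<close>). Conversely, removing low-degree vertices from the lightest scale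
upwards shows that a set without dense top-heavy subsets is the union of \<open>d\<close> independent sets and
a set occupying at most the fraction \<open>\<beta>\<close> of the vertices at every scale; summation by parts bounds the
weight of the latter by \<open>\<beta>\<close> (\<open>weight_le_of_no_dense_top_heavy\<close>). Altogether an acyclic set weighs
at most about \<open>\<beta> + d / t\<close>, which is below \<open>4L / t\<close>.
\<close>

section \<open>Duality for fractional covers\<close>

text \<open>
Weak duality: every fractional cover \<open>x\<close> satisfies
\<open>w(V) \<le> \<Sum>\<^sub>v w(v) \<Sum>\<^sub>I\<^sub>\<ni>\<^sub>v x(I) = \<Sum>\<^sub>I x(I) w(I) \<le> a \<Sum>\<^sub>I x(I)\<close>.
\<close>

lemma fractional_cover_number_ge_weight:
  assumes "finite V" "finite F" "V \<subseteq> \<Union>F" and w: "\<And>v. v \<in> V \<Longrightarrow> 0 \<le> w v"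
    and "0 < a" and le: "\<And>I. I \<in> F \<Longrightarrow> (\<Sum>v\<in>V \<inter> I. w v) \<le> a"
  shows "(\<Sum>v\<in>V. w v) / a \<le> fractional_cover_number V F"
proof -
  obtain x where x: "fractional_cover V F x" and xe: "(\<Sum>I\<in>F. x I) = fractional_cover_number V F"
    using fractional_cover_number_attained[OF assms(2,3)] by blast
  have "(\<Sum>v\<in>V. w v) \<le> (\<Sum>v\<in>V. w v * (\<Sum>I | I \<in> F \<and> v \<in> I. x I))"
  proof (intro sum_mono)
    fix v assume "v \<in> V"
    then have "1 \<le> (\<Sum>I | I \<in> F \<and> v \<in> I. x I)" using x by (auto simp: fractional_cover_def)
    then show "w v \<le> w v * (\<Sum>I | I \<in> F \<and> v \<in> I. x I)"
      using mult_left_mono[OF _ w[OF \<open>v \<in> V\<close>]] by fastforce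
  qed
  also have "\<dots> = (\<Sum>v\<in>V. \<Sum>I\<in>F. if v \<in> I then x I * w v else 0)"
    using \<open>finite F\<close> by (intro sum.cong refl) (simp add: sum_distrib_left sum.inter_filter[symmetric] mult.commute if_distrib)
  also have "\<dots> = (\<Sum>I\<in>F. \<Sum>v\<in>V. if v \<in> I then x I * w v else 0)"
    by (rule sum.swap)
  also have "\<dots> = (\<Sum>I\<in>F. x I * (\<Sum>v\<in>V \<inter> I. w v))"
    using \<open>finite V\<close> by (intro sum.cong refl) (simp add: sum_distrib_left sum.inter_restrict if_distrib cong: if_cong)
  also have "\<dots> \<le> (\<Sum>I\<in>F. x I * a)"
    using x le by (intro sum_mono mult_left_mono) (auto simp: fractional_cover_def)
  also have "\<dots> = a * fractional_cover_number V F"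
    unfolding sum_distrib_right[symmetric] xe by (rule mult.commute)
  finally show ?thesis using \<open>0 < a\<close> by (simp add: field_simps)
qed

lemma fractional_cover_number_nonneg:
  assumes "finite F" "V \<subseteq> \<Union>F"
  shows "0 \<le> fractional_cover_number V F"
proof -
  obtain x where "fractional_cover V F x" "(\<Sum>I\<in>F. x I) = fractional_cover_number V F"
    using fractional_cover_number_attained[OF assms] by blast
  then show ?thesis by (metis fractional_cover_def sum_nonneg)
qed

lemma fractional_cover_number_empty:
  assumes "finite F"
  shows "fractional_cover_number {} F = 0"
proof (rule antisym)
  show "fractional_cover_number {} F \<le> 0"
    using fractional_cover_number_attained[OF assms, of "{}"]
    by (auto simp: fractional_cover_def dest!: spec[of _ "\<lambda>_. 0"])
qed (use assms in \<open>simp add: fractional_cover_number_nonneg\<close>)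

text \<open>
The probability distributions on a finite set form a compact set in the product topology.
\<close>

lemma exists_minimal_distribution:
  fixes \<phi> :: "('b \<Rightarrow> real) \<Rightarrow> real"
  assumes F: "finite F" "F \<noteq> {}" and \<phi>: "continuous_on UNIV \<phi>"
  obtains x where "\<And>I. I \<in> F \<Longrightarrow> 0 \<le> x I" "(\<Sum>I\<in>F. x I) = 1"
    "\<And>y. \<forall>I\<in>F. 0 \<le> y I \<Longrightarrow> \<forall>I. I \<notin> F \<longrightarrow> y I = 0 \<Longrightarrow> (\<Sum>I\<in>F. y I) = 1 \<Longrightarrow> \<phi> x \<le> \<phi> y"
    "\<And>I. I \<notin> F \<Longrightarrow> x I = 0"
proof -
  define K :: "('b \<Rightarrow> real) set" where "K = (\<Pi>\<^sub>E I\<in>UNIV. if I \<in> F then {0..1} else {0})"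
  define C where "C = K \<inter> {x. (\<Sum>I\<in>F. x I) = 1}"
  have "compactin (product_topology (\<lambda>_. euclidean) UNIV) K"
    unfolding K_def by (subst compactin_PiE) auto
  then have "compact K" by (simp only: euclidean_product_topology compactin_euclidean_iff)
  moreover have "closed {x :: 'b \<Rightarrow> real. (\<Sum>I\<in>F. x I) = 1}"
    by (intro closed_Collect_eq continuous_on_sum continuous_on_product_coordinates continuous_on_const)
  ultimately have "compact C" unfolding C_def by (rule compact_Int_closed)
  have C_iff: "y \<in> C \<longleftrightarrow> (\<forall>I\<in>F. 0 \<le> y I) \<and> (\<forall>I. I \<notin> F \<longrightarrow> y I = 0) \<and> (\<Sum>I\<in>F. y I) = 1" for y
  proof
    assume "y \<in> C"
    then have "y I \<in> (if I \<in> F then {0..1} else {0})" for I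
      unfolding C_def K_def by (blast dest: PiE_mem)
    then show "(\<forall>I\<in>F. 0 \<le> y I) \<and> (\<forall>I. I \<notin> F \<longrightarrow> y I = 0) \<and> (\<Sum>I\<in>F. y I) = 1"
      using \<open>y \<in> C\<close> by (simp add: C_def) (metis atLeastAtMost_iff singletonD)
  next
    assume y: "(\<forall>I\<in>F. 0 \<le> y I) \<and> (\<forall>I. I \<notin> F \<longrightarrow> y I = 0) \<and> (\<Sum>I\<in>F. y I) = 1"
    then have "y I \<le> 1" if "I \<in> F" for I
      using member_le_sum[OF that, of y] F by auto
    then show "y \<in> C" using y by (auto simp: C_def K_def)
  qed
  obtain J where "J \<in> F" using F by blast
  then have "(\<lambda>I. if I = J then 1 else 0) \<in> C" using F by (auto simp: C_iff)
  then have "C \<noteq> {}" by blast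
  then obtain x where "x \<in> C" "\<And>y. y \<in> C \<Longrightarrow> \<phi> x \<le> \<phi> y"
    using continuous_attains_inf[OF \<open>compact C\<close> _ continuous_on_subset[OF \<phi>]] by blast
  then show ?thesis by (intro that[of x]) (simp_all add: C_iff)
qed

text \<open>
Strong duality, up to an arbitrarily small loss in \<open>c\<close>. Since \<open>c\<close> exceeds the reciprocal of the
cover number, no probability distribution \<open>x\<close> on \<open>F\<close> covers every vertex with probability at
least \<open>c\<close>. Minimise the sum of the squared deficits \<open>max 0 (c - z\<^sub>v)\<close>, where \<open>z\<^sub>v\<close> is the probability that \<open>v\<close>
is covered. The deficits \<open>w\<^sub>v\<close> at the minimum are the dual solution: moving \<open>x\<close> towards a single
member \<open>J\<close> of \<open>F\<close> cannot decrease the sum, which to first order says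
\<open>w(J) \<le> \<Sum>\<^sub>v w\<^sub>v z\<^sub>v\<close>, and \<open>z\<^sub>v \<le> c\<close> wherever \<open>w\<^sub>v > 0\<close>.
\<close>

lemma fractional_cover_dual:
  assumes V: "finite V" and F: "finite F" and cov: "V \<subseteq> \<Union>F"
    and c: "1 < c * fractional_cover_number V F"
  obtains w where "\<And>v. 0 \<le> w v" "(\<Sum>v\<in>V. w v) = 1" "\<And>I. I \<in> F \<Longrightarrow> (\<Sum>v\<in>V \<inter> I. w v) \<le> c"
proof -
  have num0: "0 \<le> fractional_cover_number V F" by (rule fractional_cover_number_nonneg[OF F cov])
  with c have "0 < c" by (metis less_le_trans mult_nonpos_nonneg not_less zero_less_one less_asym)
  have "F \<noteq> {}" using c cov fractional_cover_number_empty[of F] F by fastforce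
  define z where "z = (\<lambda>(x :: 'a set \<Rightarrow> real) v. \<Sum>I | I \<in> F \<and> v \<in> I. x I)"
  define \<phi> where "\<phi> = (\<lambda>x. \<Sum>v\<in>V. (max 0 (c - z x v))\<^sup>2)"
  have "continuous_on UNIV \<phi>"
    unfolding \<phi>_def z_def
    by (intro continuous_intros continuous_on_max continuous_on_product_coordinates)
  then obtain x where x0: "\<And>I. I \<in> F \<Longrightarrow> 0 \<le> x I" and x1: "(\<Sum>I\<in>F. x I) = 1"
    and xout: "\<And>I. I \<notin> F \<Longrightarrow> x I = 0"
    and min: "\<And>y. \<forall>I\<in>F. 0 \<le> y I \<Longrightarrow> \<forall>I. I \<notin> F \<longrightarrow> y I = 0 \<Longrightarrow> (\<Sum>I\<in>F. y I) = 1 \<Longrightarrow> \<phi> x \<le> \<phi> y"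
    using exists_minimal_distribution[OF F \<open>F \<noteq> {}\<close>] by metis
  define w where "w = (\<lambda>v. max 0 (c - z x v))"
  have w0: "0 \<le> w v" for v by (simp add: w_def)
  have "0 < (\<Sum>v\<in>V. w v)"
  proof (rule ccontr)
    assume "\<not> 0 < (\<Sum>v\<in>V. w v)"
    then have "\<forall>v\<in>V. w v = 0"
      using sum_nonneg_eq_0_iff[OF V, of w] sum_nonneg[of V w] w0 by force
    then have "\<forall>v\<in>V. c \<le> z x v" by (auto simp: w_def max_def split: if_splits)
    then have "fractional_cover V F (\<lambda>I. x I / c)"
      using x0 \<open>0 < c\<close> by (auto simp: fractional_cover_def z_def sum_divide_distrib[symmetric])
    then have "fractional_cover_number V F \<le> (\<Sum>I\<in>F. x I / c)"
      using fractional_cover_number_attained[OF F cov] by metis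
    also have "\<dots> = 1 / c" by (simp add: sum_divide_distrib[symmetric] x1)
    finally show False using c \<open>0 < c\<close> by (simp add: field_simps)
  qed
  moreover have "(\<Sum>v\<in>V \<inter> J. w v) \<le> c * (\<Sum>v\<in>V. w v)" if J: "J \<in> F" for J
  proof -
    define \<delta> where "\<delta> = (\<lambda>v. (if v \<in> J then 1 else 0) - z x v)"
    \<comment> \<open>The first-order condition, before the step length \<open>s\<close> towards \<open>J\<close> tends to \<open>0\<close>.\<close>
    have small: "2 * (\<Sum>v\<in>V. w v * \<delta> v) \<le> s * (\<Sum>v\<in>V. (\<delta> v)\<^sup>2)" if s: "0 < s" "s \<le> 1" for s
    proof -
      define y where "y = (\<lambda>I. (1 - s) * x I + s * (if I = J then 1 else 0))"
      have "(\<Sum>I\<in>F. y I) = 1"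
        using F J x1 by (simp add: y_def sum.distrib sum_distrib_left[symmetric])
      moreover have "0 \<le> y I" if "I \<in> F" for I using that s x0 by (simp add: y_def)
      moreover have "y I = 0" if "I \<notin> F" for I using that J xout by (auto simp: y_def)
      ultimately have "\<phi> x \<le> \<phi> y" using min by blast
      have zy: "z y v = z x v + s * \<delta> v" for v
      proof -
        have "finite {I. I \<in> F \<and> v \<in> I}" using F by simp
        then have "z y v = (1 - s) * z x v + s * (if v \<in> J then 1 else 0)"
          using J unfolding z_def y_def by (simp add: sum.distrib sum_distrib_left[symmetric])
        then show ?thesis by (simp add: \<delta>_def algebra_simps)
      qed
      have "(max 0 (c - z y v))\<^sup>2 \<le> (w v - s * \<delta> v)\<^sup>2" for v
      proof (cases "0 \<le> c - z y v")
        case True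
        then show ?thesis unfolding zy w_def by (intro power_mono) auto
      qed auto
      then have "\<phi> y \<le> (\<Sum>v\<in>V. (w v - s * \<delta> v)\<^sup>2)"
        unfolding \<phi>_def by (rule sum_mono)
      also have "\<dots> = \<phi> x - 2 * s * (\<Sum>v\<in>V. w v * \<delta> v) + s\<^sup>2 * (\<Sum>v\<in>V. (\<delta> v)\<^sup>2)"
        unfolding \<phi>_def w_def[symmetric] sum_distrib_left
        by (simp add: sum_subtractf[symmetric] sum.distrib[symmetric] power2_diff power_mult_distrib
            algebra_simps w_def)
      finally have "s * (2 * (\<Sum>v\<in>V. w v * \<delta> v)) \<le> s * (s * (\<Sum>v\<in>V. (\<delta> v)\<^sup>2))"
        using \<open>\<phi> x \<le> \<phi> y\<close> by (simp add: power2_eq_square algebra_simps)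
      then show ?thesis using s by simp
    qed
    have "(\<Sum>v\<in>V. w v * \<delta> v) \<le> 0"
    proof (rule ccontr)
      define A B where "A = (\<Sum>v\<in>V. w v * \<delta> v)" and "B = (\<Sum>v\<in>V. (\<delta> v)\<^sup>2)"
      assume "\<not> (\<Sum>v\<in>V. w v * \<delta> v) \<le> 0"
      then have "0 < A" by (simp add: A_def)
      have "0 \<le> B" unfolding B_def by (intro sum_nonneg) simp
      \<comment> \<open>A positive \<open>A\<close> is refuted by the step length \<open>A / (B + 1)\<close>, cut off at \<open>1\<close>.\<close>
      have "2 * A \<le> min 1 (A / (B + 1)) * B"
        unfolding A_def B_def using small \<open>0 < A\<close> \<open>0 \<le> B\<close> by (simp add: A_def B_def)
      also have "\<dots> \<le> A / (B + 1) * B" using \<open>0 \<le> B\<close> by (intro mult_right_mono) auto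
      also have "\<dots> \<le> A" using \<open>0 \<le> B\<close> \<open>0 < A\<close> by (simp add: field_simps)
      finally show False using \<open>0 < A\<close> by simp
    qed
    moreover have "w v * \<delta> v = (if v \<in> J then w v else 0) - w v * z x v" for v
      by (simp add: \<delta>_def algebra_simps)
    ultimately have "(\<Sum>v\<in>V. if v \<in> J then w v else 0) \<le> (\<Sum>v\<in>V. w v * z x v)"
      by (simp add: sum_subtractf)
    also have "\<dots> \<le> (\<Sum>v\<in>V. w v * c)"
      by (intro sum_mono) (auto simp: w_def max_def intro: mult_left_mono)
    finally show ?thesis
      using V by (simp add: sum.inter_restrict sum_distrib_left mult.commute)
  qed
  ultimately show ?thesis
    using w0 by (intro that[of "\<lambda>v. w v / (\<Sum>v\<in>V. w v)"])
      (auto simp: sum_divide_distrib[symmetric] divide_le_eq)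
qed

section \<open>Counting acyclic orientations\<close>

text \<open>
Orientations of a symmetric relation, as bare relations, so that an orientation can be cut into
its restrictions to two disjoint symmetric parts.
\<close>

definition orientations_of :: "'a rel \<Rightarrow> 'a rel set" where
  "orientations_of A = {r. r \<subseteq> A \<and> (\<forall>(u, v)\<in>A. (u, v) \<in> r \<longleftrightarrow> (v, u) \<notin> r)}"

lemma finite_orientations_of: "finite A \<Longrightarrow> finite (orientations_of A)"
  by (rule finite_subset[of _ "Pow A"]) (auto simp: orientations_of_def)

text \<open>
The level \<open>l v\<close> is the length of a longest path ending in \<open>v\<close>, and \<open>p v\<close> is the predecessor of
\<open>v\<close> on such a path. The parent function \<open>p\<close> alone determines all levels.
\<close>

lemma finite_acyclic_levels:
  assumes "finite r" "acyclic r"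
  shows "\<exists>(l :: 'a \<Rightarrow> nat) p. (\<forall>u v. (u, v) \<in> r \<longrightarrow> l u < l v) \<and> (\<forall>v. p v = None \<longrightarrow> l v = 0) \<and>
    (\<forall>u v. p v = Some u \<longrightarrow> (u, v) \<in> r \<and> l v = Suc (l u))"
proof -
  have wf: "wf r" using assms by (rule finite_acyclic_wf)
  define l :: "'a \<Rightarrow> nat" where
    "l = wfrec r (\<lambda>f v. if r\<inverse> `` {v} = {} then 0 else Suc (Max (f ` (r\<inverse> `` {v}))))"
  have l: "l v = (if r\<inverse> `` {v} = {} then 0 else Suc (Max (l ` (r\<inverse> `` {v}))))" for v
  proof -
    have "cut l r v ` (r\<inverse> `` {v}) = l ` (r\<inverse> `` {v})"
      by (intro image_cong) (auto simp: cut_apply)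
    then show ?thesis by (simp add: def_wfrec[OF l_def[THEN eq_reflection] wf, of v])
  qed
  have fin: "finite (r\<inverse> `` {v})" for v using \<open>finite r\<close> by (simp add: finite_Image)
  have mono: "l u < l v" if "(u, v) \<in> r" for u v
  proof -
    have "l u \<le> Max (l ` (r\<inverse> `` {v}))" using that fin by (intro Max_ge) auto
    moreover have "r\<inverse> `` {v} \<noteq> {}" using that by blast
    ultimately show ?thesis by (subst (2) l) simp
  qed
  define p where "p = (\<lambda>v. if r\<inverse> `` {v} = {} then None else Some (SOME u. (u, v) \<in> r \<and> l v = Suc (l u)))"
  have "(u, v) \<in> r \<and> l v = Suc (l u)" if "p v = Some u" for u v
  proof -
    have ne: "r\<inverse> `` {v} \<noteq> {}" and u: "u = (SOME u. (u, v) \<in> r \<and> l v = Suc (l u))"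
      using that by (auto simp: p_def split: if_splits)
    have "Max (l ` (r\<inverse> `` {v})) \<in> l ` (r\<inverse> `` {v})" using ne fin by (intro Max_in) auto
    then have "\<exists>u. (u, v) \<in> r \<and> l v = Suc (l u)" using ne l[of v] by auto
    then show ?thesis unfolding u by (rule someI_ex)
  qed
  moreover have "l v = 0" if "p v = None" for v
    using that l[of v] by (auto simp: p_def split: if_splits)
  ultimately show ?thesis using mono by (intro exI[of _ l] exI[of _ p]) simp
qed

text \<open>
An acyclic orientation can be recovered from its parent function: the parents determine the
levels, and every edge points from the lower to the higher level. A vertex either has no parent
or one of its neighbours as parent, which leaves one more choice than its degree.
\<close>

lemma card_acyclic_orientations_of_le:
  assumes R: "finite R" and A: "A \<subseteq> R \<times> R" and "sym A"
  shows "card {r \<in> orientations_of A. acyclic r} \<le> (\<Prod>v\<in>R. Suc (card (A `` {v})))"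
proof -
  let ?O = "{r \<in> orientations_of A. acyclic r}"
  have finA: "finite A" using R A finite_subset by blast
  define good :: "'a rel \<Rightarrow> ('a \<Rightarrow> nat) \<times> ('a \<Rightarrow> 'a option) \<Rightarrow> bool" where
    "good = (\<lambda>r (l, p). (\<forall>u v. (u, v) \<in> r \<longrightarrow> l u < l v) \<and> (\<forall>v. p v = None \<longrightarrow> l v = 0) \<and>
      (\<forall>u v. p v = Some u \<longrightarrow> (u, v) \<in> r \<and> l v = Suc (l u)))"
  have "\<exists>lp. good r lp" if "r \<in> ?O" for r
  proof -
    have "finite r" "acyclic r" using that finA finite_subset by (auto simp: orientations_of_def)
    from finite_acyclic_levels[OF this] show ?thesis by (simp add: good_def)
  qed
  then obtain F where F: "\<And>r. r \<in> ?O \<Longrightarrow> good r (F r)"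
    using bchoice[of ?O good] by blast
  define L P where "L = (\<lambda>r. fst (F r))" and "P = (\<lambda>r. snd (F r))"
  have mono: "\<And>r u v. r \<in> ?O \<Longrightarrow> (u, v) \<in> r \<Longrightarrow> L r u < L r v" and
    root: "\<And>r v. r \<in> ?O \<Longrightarrow> P r v = None \<Longrightarrow> L r v = 0" and
    parent: "\<And>r u v. r \<in> ?O \<Longrightarrow> P r v = Some u \<Longrightarrow> (u, v) \<in> r \<and> L r v = Suc (L r u)"
    using F by (auto simp: good_def L_def P_def case_prod_beta)
  have sub: "r \<subseteq> A" if "r \<in> ?O" for r using that by (simp add: orientations_of_def)
  have le: "r \<subseteq> s" if r: "r \<in> ?O" and s: "s \<in> ?O" and eq: "restrict (P r) R = restrict (P s) R" for r s
  proof -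
    have P: "P r v = P s v" if "v \<in> R" for v using fun_cong[OF eq, of v] that by simp
    have L: "L r v = L s v" if "v \<in> R" for v
      using that
    proof (induction "L r v" arbitrary: v rule: less_induct)
      case less
      show ?case
      proof (cases "P r v")
        case None
        then have "P s v = None" using P[OF less.prems] by simp
        then show ?thesis using None root[OF r] root[OF s] by simp
      next
        case (Some u)
        then have u: "(u, v) \<in> r" "L r v = Suc (L r u)" "L s v = Suc (L s u)"
          using parent[OF r, of v u] parent[OF s, of v u] P[OF less.prems] by simp_all
        then have "u \<in> R" using sub[OF r] A by blast
        then show ?thesis using u less.hyps[of u] by simp
      qed
    qed
    show "r \<subseteq> s"
    proof (clarify, rule ccontr)
      fix u v assume uv: "(u, v) \<in> r" "(u, v) \<notin> s"
      then have "(u, v) \<in> A" using sub[OF r] by blast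
      then have "(v, u) \<in> s" "u \<in> R" "v \<in> R"
        using s uv A by (auto simp: orientations_of_def)
      then show False using mono[OF r uv(1)] mono[OF s, of v u] L by simp
    qed
  qed
  have "inj_on (\<lambda>r. restrict (P r) R) ?O"
  proof (rule inj_onI)
    fix r s assume "r \<in> ?O" "s \<in> ?O" "restrict (P r) R = restrict (P s) R"
    then show "r = s" by (intro antisym le) simp_all
  qed
  moreover have "(\<lambda>r. restrict (P r) R) ` ?O \<subseteq> (\<Pi>\<^sub>E v\<in>R. insert None (Some ` (A `` {v})))"
  proof clarify
    fix r assume r: "r \<in> orientations_of A" "acyclic r"
    show "restrict (P r) R \<in> (\<Pi>\<^sub>E v\<in>R. insert None (Some ` (A `` {v})))"
    proof
      fix v assume v: "v \<in> R"
      show "restrict (P r) R v \<in> insert None (Some ` (A `` {v}))"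
      proof (cases "P r v")
        case (Some u)
        then have "(u, v) \<in> r" using parent[of r v u] r by simp
        then have "(v, u) \<in> A" using sub r \<open>sym A\<close> by (auto dest: symD)
        then show ?thesis using Some v by auto
      qed (use v in simp)
    qed simp
  qed
  moreover have finN: "finite (A `` {v})" for v using finA by (rule finite_Image)
  then have "finite (\<Pi>\<^sub>E v\<in>R. insert None (Some ` (A `` {v})))" using R by (intro finite_PiE) auto
  ultimately have "card ?O \<le> card (\<Pi>\<^sub>E v\<in>R. insert None (Some ` (A `` {v})))"
    by (rule card_inj_on_le)
  also have "\<dots> = (\<Prod>v\<in>R. Suc (card (A `` {v})))"
    unfolding card_PiE[OF R] using finN by (intro prod.cong refl) (subst card_insert_disjoint, auto simp: card_image)
  finally show ?thesis .
qed

text \<open>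
Each of the \<open>card A / 2\<close> edges can be oriented independently of the others.
\<close>

lemma card_orientations_of_ge:
  assumes A: "finite A" "sym A" "irrefl A"
  shows "sqrt 2 ^ card A \<le> real (card (orientations_of A))"
proof -
  obtain f :: "'a \<Rightarrow> nat" where f: "inj_on f (Field A)"
    using finite_imp_inj_to_nat_seg[OF finite_Field[OF A(1)]] by blast
  \<comment> \<open>One arc from every edge; an orientation is determined by the arcs of \<open>E\<close> that it keeps.\<close>
  define E where "E = {(u, v) \<in> A. f u < f v}"
  have ne: "f u \<noteq> f v" if "(u, v) \<in> A" for u v
  proof
    assume "f u = f v"
    then have "u = v" using f that by (auto dest: inj_onD simp: FieldI1 FieldI2)
    then show False using that A(3) by (auto simp: irrefl_def)
  qed
  have "E \<subseteq> A" by (auto simp: E_def)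
  then have finE: "finite E" using A(1) finite_subset by blast
  have "A = E \<union> E\<inverse>" using ne A(2) by (fastforce simp: E_def dest: symD)
  moreover have disj: "E \<inter> E\<inverse> = {}" by (auto simp: E_def)
  ultimately have cardA: "card A = 2 * card E"
    using finE by (simp add: card_Un_disjoint)
  have "inj_on (\<lambda>X. X \<union> (E - X)\<inverse>) (Pow E)"
  proof (rule inj_onI)
    fix X Y assume XY: "X \<in> Pow E" "Y \<in> Pow E" "X \<union> (E - X)\<inverse> = Y \<union> (E - Y)\<inverse>"
    then have "(X \<union> (E - X)\<inverse>) \<inter> E = (Y \<union> (E - Y)\<inverse>) \<inter> E" by simp
    then show "X = Y" using XY(1,2) disj by blast
  qed
  moreover have "(\<lambda>X. X \<union> (E - X)\<inverse>) ` Pow E \<subseteq> orientations_of A"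
    using disj \<open>A = E \<union> E\<inverse>\<close> by (fastforce simp: orientations_of_def)
  ultimately have "card (Pow E) \<le> card (orientations_of A)"
    using card_inj_on_le finite_orientations_of[OF A(1)] by blast
  then have "real (2 ^ card E) \<le> real (card (orientations_of A))"
    using finE by (simp only: card_Pow of_nat_le_iff)
  then show ?thesis by (simp add: cardA power_mult)
qed

text \<open>
Orientations of \<open>B\<close> and of the remaining edges can be combined freely.
\<close>

lemma card_orientations_of_mult_le:
  assumes "finite A" "sym B" "B \<subseteq> A"
  shows "card (orientations_of B) * card (orientations_of (A - B)) \<le> card (orientations_of A)"
proof -
  have "inj_on (\<lambda>(r, s). r \<union> s) (orientations_of B \<times> orientations_of (A - B))"
    by (rule inj_onI) (auto simp: orientations_of_def)
  moreover have "(\<lambda>(r, s). r \<union> s) ` (orientations_of B \<times> orientations_of (A - B)) \<subseteq> orientations_of A"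
  proof clarify
    fix r s assume rs: "r \<in> orientations_of B" "s \<in> orientations_of (A - B)"
    have "(u, v) \<in> r \<union> s \<longleftrightarrow> (v, u) \<notin> r \<union> s" if "(u, v) \<in> A" for u v
    proof (cases "(u, v) \<in> B")
      case True
      then have "(v, u) \<in> B" using \<open>sym B\<close> by (auto dest: symD)
      then show ?thesis using True rs by (auto simp: orientations_of_def)
    next
      case False
      then have "(v, u) \<notin> B" using \<open>sym B\<close> by (auto dest: symD)
      then show ?thesis using False rs that by (auto simp: orientations_of_def)
    qed
    then show "r \<union> s \<in> orientations_of A" using rs \<open>B \<subseteq> A\<close> by (auto simp: orientations_of_def)
  qed
  ultimately have "card (orientations_of B \<times> orientations_of (A - B)) \<le> card (orientations_of A)"
    using card_inj_on_le finite_orientations_of[OF assms(1)] by blast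
  then show ?thesis by (simp add: card_cartesian_product)
qed

lemma card_orientations_of_acyclic_le:
  assumes "finite A" "sym B" "B \<subseteq> A"
  shows "card {r \<in> orientations_of A. acyclic (r \<inter> B)} \<le>
    card {r \<in> orientations_of B. acyclic r} * card (orientations_of (A - B))"
proof -
  let ?O = "{r \<in> orientations_of A. acyclic (r \<inter> B)}"
  let ?P = "{r \<in> orientations_of B. acyclic r} \<times> orientations_of (A - B)"
  have "inj_on (\<lambda>r. (r \<inter> B, r - B)) ?O" by (rule inj_onI) blast
  moreover have "(\<lambda>r. (r \<inter> B, r - B)) ` ?O \<subseteq> ?P"
    using assms(2,3) by (fastforce simp: orientations_of_def dest: symD)
  moreover have "finite ?P"
    using assms(1) finite_subset[OF \<open>B \<subseteq> A\<close>]
    by (intro finite_cartesian_product) (simp_all add: finite_orientations_of)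
  ultimately have "card ?O \<le> card ?P" by (rule card_inj_on_le)
  then show ?thesis by (simp add: card_cartesian_product)
qed

text \<open>
A uniformly random orientation is acyclic on \<open>R\<close> with probability at most the product over
\<open>v \<in> R\<close> of \<open>(deg v + 1) 2\<^bsup>-deg v / 2\<^esup>\<close>: there are at most \<open>\<Prod>(deg v + 1)\<close> acyclic
orientations among the \<open>2\<^bsup>e\<^esup>\<close> orientations of the \<open>e\<close> edges inside \<open>R\<close>, and the degrees
add up to \<open>2e\<close>. Probabilities are expressed by counting.
\<close>

lemma card_orientations_of_acyclic_on_le:
  assumes A: "finite A" "sym A" "irrefl A" and R: "finite R"
  defines "deg \<equiv> \<lambda>v. card {u \<in> R. (v, u) \<in> A}"
  shows "real (card {r \<in> orientations_of A. acyclic (r \<inter> R \<times> R)}) \<le>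
    (\<Prod>v\<in>R. (real (deg v) + 1) / sqrt 2 ^ deg v) * real (card (orientations_of A))"
proof -
  define B where "B = A \<inter> R \<times> R"
  have B: "finite B" "sym B" "irrefl B" "B \<subseteq> A" "B \<subseteq> R \<times> R"
    using A by (auto simp: B_def sym_def irrefl_def)
  have deg: "card (B `` {v}) = deg v" if "v \<in> R" for v
    unfolding deg_def using that by (intro arg_cong[of _ _ card]) (auto simp: B_def)
  have "B = (SIGMA v:R. B `` {v})" using B(5) by auto
  then have "card B = (\<Sum>v\<in>R. card (B `` {v}))"
    using card_SigmaI[OF R, of "\<lambda>v. B `` {v}"] B(1) by (simp add: finite_Image)
  then have cardB: "card B = (\<Sum>v\<in>R. deg v)" using deg by simp
  let ?bad = "card {r \<in> orientations_of A. acyclic (r \<inter> R \<times> R)}"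
  let ?ac = "card {r \<in> orientations_of B. acyclic r}"
  let ?rest = "card (orientations_of (A - B))"
  have "r \<inter> R \<times> R = r \<inter> B" if "r \<in> orientations_of A" for r
    using that by (auto simp: B_def orientations_of_def)
  then have "{r \<in> orientations_of A. acyclic (r \<inter> R \<times> R)} = {r \<in> orientations_of A. acyclic (r \<inter> B)}"
    by auto
  then have bad: "real ?bad \<le> real ?ac * real ?rest"
    using of_nat_mono[OF card_orientations_of_acyclic_le[OF A(1) B(2,4)], where ?'a = real]
    by (simp only: of_nat_mult)
  have "real ?ac \<le> real (\<Prod>v\<in>R. Suc (card (B `` {v})))"
    using card_acyclic_orientations_of_le[OF R B(5,2)] by (simp only: of_nat_le_iff)
  also have "\<dots> = (\<Prod>v\<in>R. real (deg v) + 1)" using deg by (simp add: add.commute)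
  finally have ac: "real ?ac \<le> (\<Prod>v\<in>R. real (deg v) + 1)" .
  have "sqrt 2 ^ card B * real ?rest \<le> real (card (orientations_of B)) * real ?rest"
    by (intro mult_right_mono card_orientations_of_ge B) simp
  also have "\<dots> \<le> real (card (orientations_of A))"
    using of_nat_mono[OF card_orientations_of_mult_le[OF A(1) B(2,4)], where ?'a = real]
    by (simp only: of_nat_mult)
  finally have rest: "real ?rest \<le> real (card (orientations_of A)) / sqrt 2 ^ card B"
    by (simp add: field_simps)
  have "real ?bad \<le> (\<Prod>v\<in>R. real (deg v) + 1) * (real (card (orientations_of A)) / sqrt 2 ^ card B)"
    using bad mult_mono[OF ac rest] by (simp add: prod_nonneg)
  also have "\<dots> = (\<Prod>v\<in>R. (real (deg v) + 1) / sqrt 2 ^ deg v) * real (card (orientations_of A))"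
    by (simp add: cardB power_sum prod_dividef)
  finally show ?thesis .
qed

text \<open>
Passing from \<open>n\<close> to \<open>n + 1\<close> multiplies the factor by \<open>(n + 2) / ((n + 1) \<surd>2)\<close>, which is at most
\<open>1\<close> from \<open>n = 2\<close> on.
\<close>

lemma degree_factor_antimono:
  assumes "2 \<le> d" "d \<le> n"
  shows "(real n + 1) / sqrt 2 ^ n \<le> (real d + 1) / sqrt 2 ^ d"
  using assms(2)
proof (induction n rule: dec_induct)
  case (step n)
  have "4 / 3 \<le> sqrt 2" by (rule real_le_rsqrt) (simp add: power2_eq_square)
  then have "4 / 3 * (real n + 1) \<le> sqrt 2 * (real n + 1)" by (intro mult_right_mono) auto
  then have "real (Suc n) + 1 \<le> sqrt 2 * (real n + 1)" using step.hyps(1) assms(1) by simp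
  then have "(real (Suc n) + 1) / sqrt 2 ^ Suc n \<le> sqrt 2 * (real n + 1) / sqrt 2 ^ Suc n"
    by (intro divide_right_mono) auto
  also have "\<dots> = (real n + 1) / sqrt 2 ^ n" by simp
  finally have "(real (Suc n) + 1) / sqrt 2 ^ Suc n \<le> (real n + 1) / sqrt 2 ^ n" .
  then show ?case using step.IH by linarith
qed simp

lemma card_orientations_of_acyclic_on_le_min_degree:
  assumes A: "finite A" "sym A" "irrefl A" and R: "finite R" and "2 \<le> d"
    and min_deg: "\<And>v. v \<in> R \<Longrightarrow> d \<le> card {u \<in> R. (v, u) \<in> A}"
  shows "real (card {r \<in> orientations_of A. acyclic (r \<inter> R \<times> R)}) \<le>
    ((real d + 1) / sqrt 2 ^ d) ^ card R * real (card (orientations_of A))"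
proof -
  have "(\<Prod>v\<in>R. (real (card {u \<in> R. (v, u) \<in> A}) + 1) / sqrt 2 ^ card {u \<in> R. (v, u) \<in> A})
      \<le> (\<Prod>v\<in>R. (real d + 1) / sqrt 2 ^ d)"
    using min_deg \<open>2 \<le> d\<close> by (intro prod_mono conjI degree_factor_antimono) auto
  also have "\<dots> = ((real d + 1) / sqrt 2 ^ d) ^ card R" by simp
  finally show ?thesis
    by (intro order_trans[OF card_orientations_of_acyclic_on_le[OF A R]] mult_right_mono) simp_all
qed

lemma acyclic_sets_imp_acyclic:
  assumes "pair_wf_digraph D" and S: "S \<in> acyclic_sets D" and "R \<subseteq> S"
  shows "acyclic (parcs D \<inter> R \<times> R)"
proof -
  interpret pair_wf_digraph D by fact
  interpret I: wf_digraph "with_proj D \<restriction> S" by (rule wellformed_induce_subgraph)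
  have "arcs_ends (with_proj D \<restriction> S) = parcs D \<inter> S \<times> S"
    by (auto simp: arcs_ends_def arc_to_ends_def)
  moreover have "(u, u) \<notin> (arcs_ends (with_proj D \<restriction> S))\<^sup>+" for u
  proof
    assume "(u, u) \<in> (arcs_ends (with_proj D \<restriction> S))\<^sup>+"
    then obtain p where "I.awalk u p u" "p \<noteq> []" using I.reachable1_awalk by blast
    then have "I.closed_w p" by (auto simp: I.closed_w_def)
    then show False using I.closed_w_imp_cycle S by (auto simp: acyclic_sets_def)
  qed
  ultimately have "acyclic (parcs D \<inter> S \<times> S)" by (simp add: acyclic_def)
  then show ?thesis by (rule acyclic_subset) (use \<open>R \<subseteq> S\<close> in blast)
qed

section \<open>A union bound over top-heavy sets\<close>

text \<open>
The term of index \<open>r\<close> in the exponential series of \<open>e\<^sup>r\<close> is at most the sum of the series.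
\<close>

lemma self_power_le_fact_exp: "real r ^ r \<le> fact r * exp 1 ^ r"
proof -
  have "(\<Sum>n\<in>{r}. real r ^ n /\<^sub>R fact n) \<le> (\<Sum>n. real r ^ n /\<^sub>R fact n)"
    by (rule sum_le_suminf[OF summable_exp_generic]) auto
  then have "real r ^ r / fact r \<le> exp (real r)" by (simp add: exp_def field_simps)
  also have "\<dots> = exp 1 ^ r" by (simp add: exp_of_nat_mult[symmetric])
  finally show ?thesis by (simp add: field_simps)
qed

lemma binomial_le_exp_power:
  assumes "real n \<le> real r * y"
  shows "real (n choose r) \<le> (exp 1 * y) ^ r"
proof (cases "r = 0")
  case False
  then have "0 < real r" by simp
  moreover have "0 \<le> real r * y" using assms of_nat_0_le_iff[of n] by linarith
  ultimately have "0 \<le> y" by (simp add: zero_le_mult_iff)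
  have "real (n choose r) * fact r \<le> real n ^ r"
    using of_nat_mono[OF binomial_fact_pow[of n r], where ?'a = real] by simp
  also have "\<dots> \<le> (real r * y) ^ r" using assms by (intro power_mono) auto
  also have "\<dots> \<le> (fact r * exp 1 ^ r) * y ^ r"
    unfolding power_mult_distrib using self_power_le_fact_exp \<open>0 \<le> y\<close> by (intro mult_right_mono) auto
  finally have "fact r * real (n choose r) \<le> fact r * (exp 1 * y) ^ r" by (simp add: power_mult_distrib mult_ac)
  then show ?thesis by simp
qed simp

definition weight_rank :: "'a set \<Rightarrow> ('a \<Rightarrow> real) \<Rightarrow> 'a \<Rightarrow> nat" where
  "weight_rank V w v = card {u \<in> V. w v \<le> w u}"

text \<open>
The sets \<open>{u \<in> V. w v \<le> w u}\<close> form a chain, so the vertices of small rank all lie in the one that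
belongs to the lightest of them.
\<close>

lemma card_weight_rank_less:
  assumes "finite V" "0 < x"
  shows "real (card {v \<in> V. real (weight_rank V w v) < x}) < x"
proof (cases "{v \<in> V. real (weight_rank V w v) < x} = {}")
  case True
  then show ?thesis using \<open>0 < x\<close> by (simp only: card.empty)
next
  case False
  define U where "U = {v \<in> V. real (weight_rank V w v) < x}"
  have fin: "finite (w ` U)" "w ` U \<noteq> {}" using False assms(1) by (auto simp: U_def)
  obtain v where v: "v \<in> U" "w v = Min (w ` U)" using Min_in[OF fin] by auto
  have "U \<subseteq> {u \<in> V. w v \<le> w u}" using v fin by (auto simp: U_def)
  then have "card U \<le> weight_rank V w v" unfolding weight_rank_def using assms(1) by (intro card_mono) auto
  then show ?thesis using v by (simp add: U_def)
qed

text \<open>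
The size of \<open>R\<close> is measured at the scale of its lightest member, for which the condition is
strongest: \<open>R\<close> makes up more than the fraction \<open>\<beta>\<close> of all vertices that are at least as heavy.
\<close>

definition top_heavy :: "'a set \<Rightarrow> ('a \<Rightarrow> real) \<Rightarrow> real \<Rightarrow> 'a set \<Rightarrow> bool" where
  "top_heavy V w \<beta> R \<longleftrightarrow> R \<noteq> {} \<and> R \<subseteq> V \<and> (\<forall>v\<in>R. \<beta> * real (weight_rank V w v) < real (card R))"

text \<open>
If vertex sets of size \<open>r\<close> are bad with probability at most \<open>g\<^sup>r\<close>, then with positive probability no
top-heavy set is bad. This is where the notion pays off: all top-heavy sets of size \<open>r\<close> lie
in one set of fewer than \<open>r / \<beta>\<close> vertices, whatever the size of \<open>V\<close>, so there are at
most \<open>(e / \<beta>)\<^sup>r\<close> of them.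
\<close>

lemma sum_top_heavy_less_one:
  assumes V: "finite V" and \<beta>: "0 < \<beta>" and g: "0 \<le> g" and q: "exp 1 * g / \<beta> \<le> 1 / 4"
  shows "(\<Sum>R | top_heavy V w \<beta> R. g ^ card R) < 1"
proof -
  let ?T = "{R. top_heavy V w \<beta> R}"
  have "?T \<subseteq> Pow V" by (auto simp: top_heavy_def)
  then have finT: "finite ?T" using V finite_subset by blast
  have "(\<Sum>R\<in>?T. g ^ card R) = (\<Sum>r\<in>{1..card V}. \<Sum>R | R \<in> ?T \<and> card R = r. g ^ card R)"
  proof (rule sum.group[symmetric, OF finT])
    show "card ` ?T \<subseteq> {1..card V}"
    proof clarify
      fix R assume "top_heavy V w \<beta> R"
      then have "R \<subseteq> V" "R \<noteq> {}" by (auto simp: top_heavy_def)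
      then show "card R \<in> {1..card V}"
        using V by (auto simp: card_mono Suc_le_eq card_gt_0_iff finite_subset)
    qed
  qed simp
  also have "\<dots> \<le> (\<Sum>r\<in>{1..card V}. (1 / 4) ^ r)"
  proof (rule sum_mono)
    fix r assume r: "r \<in> {1..card V}"
    \<comment> \<open>This set contains every top-heavy set of size \<open>r\<close>.\<close>
    define U where "U = {v \<in> V. real (weight_rank V w v) < real r / \<beta>}"
    have finU: "finite U" using V by (simp add: U_def)
    have "{R. R \<in> ?T \<and> card R = r} \<subseteq> {R. R \<subseteq> U \<and> card R = r}"
      using \<beta> by (auto simp: top_heavy_def U_def field_simps)
    then have "card {R. R \<in> ?T \<and> card R = r} \<le> card {R. R \<subseteq> U \<and> card R = r}"
      using finU by (intro card_mono) auto
    also have "\<dots> = card U choose r" using finU by (rule n_subsets)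
    finally have "real (card {R. R \<in> ?T \<and> card R = r}) \<le> real (card U choose r)" by simp
    also have "\<dots> \<le> (exp 1 * (1 / \<beta>)) ^ r"
      using card_weight_rank_less[OF V, of "real r / \<beta>" w] r \<beta>
      by (intro binomial_le_exp_power) (simp add: U_def)
    finally have *: "real (card {R. R \<in> ?T \<and> card R = r}) \<le> (exp 1 / \<beta>) ^ r" by simp
    have "(\<Sum>R | R \<in> ?T \<and> card R = r. g ^ card R) = real (card {R. R \<in> ?T \<and> card R = r}) * g ^ r"
      by simp
    also have "\<dots> \<le> (exp 1 / \<beta>) ^ r * g ^ r" using * g by (intro mult_right_mono) auto
    also have "\<dots> = (exp 1 * g / \<beta>) ^ r" by (simp add: power_mult_distrib power_divide)
    also have "\<dots> \<le> (1 / 4) ^ r" using q g \<beta> by (intro power_mono) auto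
    finally show "(\<Sum>R | R \<in> ?T \<and> card R = r. g ^ card R) \<le> (1 / 4) ^ r" .
  qed
  also have "\<dots> < 1"
  proof -
    have "(\<Sum>r\<in>{1..n}. (1 / 4 :: real) ^ r) \<le> 1 / 3 - (1 / 4) ^ n / 3" for n
    proof (induction n)
      case (Suc n)
      have "(1 / 4 :: real) ^ Suc n = (1 / 4) ^ n / 4" by simp
      moreover have "(\<Sum>r\<in>{1..Suc n}. (1 / 4 :: real) ^ r) = (\<Sum>r\<in>{1..n}. (1 / 4) ^ r) + (1 / 4) ^ Suc n"
        by simp
      ultimately show ?case using Suc.IH by linarith
    qed simp
    from this[of "card V"] show ?thesis
      using zero_le_power[of "1 / 4 :: real" "card V"] by linarith
  qed
  finally show ?thesis .
qed


section \<open>Heavy sets contain dense top-heavy sets\<close>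

text \<open>
Summation by parts: \<open>w\<close> is a nonnegative combination of indicator functions of the sets
\<open>{u \<in> V. w y \<le> w u}\<close>. The induction peels off the minimal weight.
\<close>

lemma weighted_sum_nonneg:
  fixes w f :: "'a \<Rightarrow> real"
  assumes "finite V" "\<And>v. v \<in> V \<Longrightarrow> 0 \<le> w v"
    and "\<And>y. y \<in> V \<Longrightarrow> 0 \<le> (\<Sum>u | u \<in> V \<and> w y \<le> w u. f u)"
  shows "0 \<le> (\<Sum>v\<in>V. w v * f v)"
  using assms
proof (induction V arbitrary: w rule: finite_psubset_induct)
  case (psubset V)
  show ?case
  proof (cases "V = {}")
    case False
    define m where "m = Min (w ` V)"
    have "m \<in> w ` V" unfolding m_def using psubset.hyps False by (intro Min_in) auto
    then obtain y where y: "y \<in> V" "w y = m" by blast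
    have m: "m \<le> w v" if "v \<in> V" for v using that psubset.hyps by (simp add: m_def)
    define V' where "V' = {v \<in> V. m < w v}"
    have "V' \<subset> V" using y by (auto simp: V'_def)
    have "0 \<le> (\<Sum>v\<in>V'. (w v - m) * f v)"
    proof (rule psubset.IH[OF \<open>V' \<subset> V\<close>])
      fix x assume x: "x \<in> V'"
      then have "{u \<in> V'. w x - m \<le> w u - m} = {u \<in> V. w x \<le> w u}" by (auto simp: V'_def)
      then show "0 \<le> (\<Sum>u | u \<in> V' \<and> w x - m \<le> w u - m. f u)"
        using psubset.prems(2)[of x] x by (simp add: V'_def)
    qed (simp add: V'_def)
    moreover have "(\<Sum>v\<in>V'. (w v - m) * f v) = (\<Sum>v\<in>V. (w v - m) * f v)"
      using psubset.hyps m by (intro sum.mono_neutral_left) (force simp: V'_def)+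
    moreover have "{u \<in> V. w y \<le> w u} = V" using y m by auto
    then have "0 \<le> m * (\<Sum>v\<in>V. f v)"
      using psubset.prems(1)[OF y(1)] psubset.prems(2)[OF y(1)] y(2) by simp
    ultimately have "0 \<le> (\<Sum>v\<in>V. (w v - m) * f v) + m * (\<Sum>v\<in>V. f v)" by simp
    also have "\<dots> = (\<Sum>v\<in>V. w v * f v)"
      unfolding sum_distrib_left sum.distrib[symmetric] by (simp add: algebra_simps)
    finally show ?thesis .
  qed simp
qed

text \<open>
The set \<open>Q\<close> is what remains of \<open>S\<close> when vertices of low degree are removed from the lightest
scale upwards, and \<open>col\<close> colours the removed vertices.

Call \<open>y\<close> a violator if \<open>S\<close> occupies more than this fraction of \<open>{u \<in> V. w y \<le> w u}\<close>. For a
lightest violator \<open>y\<close>, the set \<open>R\<close> of those elements of \<open>S\<close> that are at least as heavy as \<open>y\<close> is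
top-heavy. Remove from \<open>S\<close> a vertex \<open>v\<close> of \<open>R\<close> with fewer than \<open>d\<close> neighbours in \<open>R\<close>, and
continue. When the colours are assigned in the reverse order, \<open>v\<close> must only avoid its neighbours in
\<open>R\<close>, because lighter vertices are never removed later: as \<open>S\<close> shrinks, no new violators arise. The
third conjunct carries this last fact through the induction.
\<close>

lemma exists_sparse_remainder:
  fixes w :: "'a \<Rightarrow> real"
  assumes V: "finite V" and \<beta>: "0 \<le> \<beta>" and A: "sym A" "irrefl A"
    and "S \<subseteq> V"
    and low: "\<forall>R\<subseteq>S. top_heavy V w \<beta> R \<longrightarrow> (\<exists>v\<in>R. card {u \<in> R. (v, u) \<in> A} < d)"
  shows "\<exists>Q col. Q \<subseteq> S \<and> (\<forall>y\<in>V. real (card {u \<in> Q. w y \<le> w u}) \<le> \<beta> * weight_rank V w y) \<and>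
    (\<forall>v\<in>S. (\<forall>y\<in>V. w y \<le> w v \<longrightarrow> real (card {u \<in> S. w y \<le> w u}) \<le> \<beta> * weight_rank V w y) \<longrightarrow> v \<in> Q) \<and>
    (\<forall>v\<in>S - Q. col v < d \<and> (\<forall>u\<in>S - Q. (v, u) \<in> A \<longrightarrow> col u \<noteq> (col v :: nat)))"
proof -
  have "finite S" using V \<open>S \<subseteq> V\<close> finite_subset by blast
  then show ?thesis using \<open>S \<subseteq> V\<close> low
  proof (induction S rule: finite_psubset_induct)
    case (psubset S)
    define bad where "bad = {y \<in> V. \<beta> * weight_rank V w y < real (card {u \<in> S. w y \<le> w u})}"
    show ?case
    proof (cases "bad = {}")
      case True
      then have "\<forall>y\<in>V. real (card {u \<in> S. w y \<le> w u}) \<le> \<beta> * weight_rank V w y"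
        by (auto simp: bad_def not_less)
      then show ?thesis by (intro exI[of _ S]) auto
    next
      case False
      have finb: "finite (w ` bad)" "w ` bad \<noteq> {}" using False V by (auto simp: bad_def)
      obtain y where y: "y \<in> bad" "w y = Min (w ` bad)" using Min_in[OF finb] by auto
      have ymin: "w y \<le> w x" if "x \<in> bad" for x using that y finb by simp
      define R where "R = {u \<in> S. w y \<le> w u}"
      have yV: "y \<in> V" and big: "\<beta> * weight_rank V w y < real (card R)" using y(1) by (auto simp: bad_def R_def)
      have "top_heavy V w \<beta> R"
        unfolding top_heavy_def
      proof (intro conjI ballI)
        have "0 \<le> \<beta> * weight_rank V w y" using \<beta> by simp
        then have "0 < real (card R)" using big by linarith
        then show "R \<noteq> {}" by auto
        show "R \<subseteq> V" using psubset.prems(1) by (auto simp: R_def)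
        fix v assume "v \<in> R"
        then have "weight_rank V w v \<le> weight_rank V w y"
          unfolding weight_rank_def using V by (intro card_mono) (auto simp: R_def)
        then have "\<beta> * weight_rank V w v \<le> \<beta> * weight_rank V w y" using \<beta> by (simp add: mult_left_mono)
        then show "\<beta> * weight_rank V w v < real (card R)" using big by linarith
      qed
      then obtain v where v: "v \<in> R" "card {u \<in> R. (v, u) \<in> A} < d"
        using spec[OF psubset.prems(2), of R] by (auto simp: R_def)
      have vS: "v \<in> S" "w y \<le> w v" using v(1) by (auto simp: R_def)
      define S' where "S' = S - {v}"
      have "S' \<subset> S" using vS by (auto simp: S'_def)
      then have "S' \<subseteq> V" "\<forall>R\<subseteq>S'. top_heavy V w \<beta> R \<longrightarrow> (\<exists>v\<in>R. card {u \<in> R. (v, u) \<in> A} < d)"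
        using psubset.prems by blast+
      note IH = psubset.IH[OF \<open>S' \<subset> S\<close> this]
      obtain Q col where Q: "Q \<subseteq> S'"
        and light: "\<forall>y\<in>V. real (card {u \<in> Q. w y \<le> w u}) \<le> \<beta> * weight_rank V w y"
        and keep: "\<forall>x\<in>S'. (\<forall>y\<in>V. w y \<le> w x \<longrightarrow> real (card {u \<in> S'. w y \<le> w u}) \<le> \<beta> * weight_rank V w y) \<longrightarrow> x \<in> Q"
        and col: "\<forall>x\<in>S' - Q. col x < d \<and> (\<forall>u\<in>S' - Q. (x, u) \<in> A \<longrightarrow> col u \<noteq> (col x :: nat))"
        using IH by blast
      have shrink: "real (card {u \<in> S'. w x \<le> w u}) \<le> real (card {u \<in> S. w x \<le> w u})" for x
        using psubset.hyps \<open>S' \<subset> S\<close> by (intro of_nat_mono card_mono) auto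
      have keepS: "x \<in> Q" if "x \<in> S" and *: "\<forall>y\<in>V. w y \<le> w x \<longrightarrow> real (card {u \<in> S. w y \<le> w u}) \<le> \<beta> * weight_rank V w y" for x
      proof -
        have "x \<noteq> v" using * yV vS big by (auto simp: R_def)
        then have "x \<in> S'" using \<open>x \<in> S\<close> by (simp add: S'_def)
        moreover have "\<forall>y\<in>V. w y \<le> w x \<longrightarrow> real (card {u \<in> S'. w y \<le> w u}) \<le> \<beta> * weight_rank V w y"
          using * shrink order_trans by blast
        ultimately show ?thesis using keep by blast
      qed
      have "S' - Q \<subseteq> R"
      proof
        fix x assume x: "x \<in> S' - Q"
        show "x \<in> R"
        proof (rule ccontr)
          assume "x \<notin> R"
          then have "w x < w y" using x by (auto simp: R_def S'_def)
          then have "\<forall>z\<in>V. w z \<le> w x \<longrightarrow> real (card {u \<in> S. w z \<le> w u}) \<le> \<beta> * weight_rank V w z"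
            using ymin by (force simp: bad_def)
          then show False using keepS x by (auto simp: S'_def)
        qed
      qed
      define N where "N = {u \<in> S' - Q. (v, u) \<in> A}"
      have "card N \<le> card {u \<in> R. (v, u) \<in> A}"
        using \<open>S' - Q \<subseteq> R\<close> psubset.hyps by (intro card_mono) (auto simp: N_def R_def)
      then have "card (col ` N) < d"
        using v(2) card_image_le[of N col] psubset.hyps by (simp add: N_def S'_def)
      then obtain k where k: "k < d" "k \<notin> col ` N"
        using card_mono[of "col ` N" "{..<d}"] psubset.hyps by (force simp: N_def S'_def)
      have SQ: "S - Q = insert v (S' - Q)" using vS Q by (auto simp: S'_def)
      have irr: "(x, x) \<notin> A" for x using A(2) by (auto simp: irrefl_def)
      \<comment> \<open>The colouring of the rest extends to \<open>v\<close> by a colour \<open>k\<close> unused in its neighbourhood.\<close>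
      have colk: "(col(v := k)) x < d \<and> (\<forall>u\<in>S - Q. (x, u) \<in> A \<longrightarrow> (col(v := k)) u \<noteq> (col(v := k)) x)" if x: "x \<in> S - Q" for x
      proof (cases "x = v")
        case True
        have "col u \<noteq> k" if "u \<in> S - Q" "(v, u) \<in> A" "u \<noteq> v" for u
          using that k by (auto simp: N_def S'_def)
        then show ?thesis using True k irr by auto
      next
        case False
        then have "x \<in> S' - Q" using x SQ by blast
        moreover have "col x \<noteq> k" if "(x, v) \<in> A"
        proof -
          have "(v, x) \<in> A" using that A(1) by (auto dest: symD)
          then show ?thesis using \<open>x \<in> S' - Q\<close> k by (auto simp: N_def)
        qed
        ultimately show ?thesis using col False unfolding SQ by auto
      qed
      show ?thesis
      proof (intro exI conjI)
        show "Q \<subseteq> S" using Q \<open>S' \<subset> S\<close> by blast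
        show "\<forall>x\<in>S - Q. (col(v := k)) x < d \<and> (\<forall>u\<in>S - Q. (x, u) \<in> A \<longrightarrow> (col(v := k)) u \<noteq> (col(v := k)) x)"
          using colk by blast
      qed (use light keepS in blast)+
    qed
  qed
qed

text \<open>
The part \<open>Q\<close> of \<open>exists_sparse_remainder\<close> has at most the fraction \<open>\<beta>\<close> of the total weight, and
each of the \<open>d\<close> colour classes of the rest is independent.
\<close>

lemma weight_le_of_no_dense_top_heavy:
  fixes w :: "'a \<Rightarrow> real"
  assumes V: "finite V" and \<beta>: "0 \<le> \<beta>" and A: "sym A" "irrefl A"
    and S: "S \<subseteq> V" and w: "\<And>v. v \<in> V \<Longrightarrow> 0 \<le> w v"
    and low: "\<And>R. R \<subseteq> S \<Longrightarrow> top_heavy V w \<beta> R \<Longrightarrow> \<exists>v\<in>R. card {u \<in> R. (v, u) \<in> A} < d"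
    and indep: "\<And>I. I \<subseteq> V \<Longrightarrow> (\<forall>u\<in>I. \<forall>v\<in>I. (u, v) \<notin> A) \<Longrightarrow> (\<Sum>v\<in>I. w v) \<le> c"
  shows "(\<Sum>v\<in>S. w v) \<le> \<beta> * (\<Sum>v\<in>V. w v) + real d * c"
proof -
  obtain Q and col :: "'a \<Rightarrow> nat" where Q: "Q \<subseteq> S"
    and light: "\<And>y. y \<in> V \<Longrightarrow> real (card {u \<in> Q. w y \<le> w u}) \<le> \<beta> * weight_rank V w y"
    and col: "\<And>v. v \<in> S - Q \<Longrightarrow> col v < d"
      "\<And>u v. u \<in> S - Q \<Longrightarrow> v \<in> S - Q \<Longrightarrow> (v, u) \<in> A \<Longrightarrow> col u \<noteq> col v"
  proof -
    obtain Q and col :: "'a \<Rightarrow> nat" where Q: "Q \<subseteq> S"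
      "\<forall>y\<in>V. real (card {u \<in> Q. w y \<le> w u}) \<le> \<beta> * weight_rank V w y"
      "\<forall>v\<in>S - Q. col v < d \<and> (\<forall>u\<in>S - Q. (v, u) \<in> A \<longrightarrow> col u \<noteq> col v)"
      using exists_sparse_remainder[OF V \<beta> A S, of w d] low by blast
    show thesis by (rule that[of Q col]) (use Q in blast)+
  qed
  have fin: "finite S" "finite Q"
    using finite_subset[OF S V] finite_subset[OF Q finite_subset[OF S V]] by simp_all
  \<comment> \<open>Summation by parts turns the bound on the cardinalities into one on the weights.\<close>
  have "0 \<le> (\<Sum>v\<in>V. w v * (\<beta> - (if v \<in> Q then 1 else 0)))"
  proof (rule weighted_sum_nonneg[OF V w])
    fix y assume "y \<in> V"
    have "{u \<in> V. w y \<le> w u} \<inter> Q = {u \<in> Q. w y \<le> w u}" using S Q by auto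
    then have "(\<Sum>u | u \<in> V \<and> w y \<le> w u. \<beta> - (if u \<in> Q then 1 else 0)) =
        \<beta> * weight_rank V w y - card {u \<in> Q. w y \<le> w u}"
      using V by (simp add: sum_subtractf weight_rank_def sum.inter_restrict[symmetric] mult.commute)
    then show "0 \<le> (\<Sum>u | u \<in> V \<and> w y \<le> w u. \<beta> - (if u \<in> Q then 1 else 0))"
      using light[OF \<open>y \<in> V\<close>] by simp
  qed
  also have "\<dots> = \<beta> * (\<Sum>v\<in>V. w v) - (\<Sum>v\<in>V. if v \<in> Q then w v else 0)"
    unfolding sum_distrib_left sum_subtractf[symmetric] by (intro sum.cong) (auto simp: algebra_simps)
  also have "(\<Sum>v\<in>V. if v \<in> Q then w v else 0) = (\<Sum>v\<in>Q. w v)"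
    using V S Q by (simp add: sum.inter_restrict[symmetric] Int_absorb1)
  finally have wQ: "(\<Sum>v\<in>Q. w v) \<le> \<beta> * (\<Sum>v\<in>V. w v)" by simp
  have "(\<Sum>v\<in>S - Q. w v) = (\<Sum>k\<in>{..<d}. \<Sum>v | v \<in> S - Q \<and> col v = k. w v)"
    using fin col(1) by (intro sum.group[symmetric]) auto
  also have "\<dots> \<le> (\<Sum>k\<in>{..<d}. c)"
    using S col(2) by (intro sum_mono indep) auto
  finally have "(\<Sum>v\<in>S - Q. w v) \<le> real d * c" by simp
  then show ?thesis using wQ sum.subset_diff[OF Q fin(1), of w] by simp
qed

section \<open>An orientation in which every acyclic set is light\<close>

lemma orientations_eq_orientations_of:
  "orientations G = {D. pverts D = pverts G \<and> parcs D \<in> orientations_of (parcs G)}"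
  by (auto simp: orientations_def orientations_of_def)

text \<open>
A random orientation, expressed by counting: with positive probability, no top-heavy set of minimum
degree at least \<open>d\<close> is acyclic. In such an orientation the top-heavy subsets of an acyclic set
all have a vertex of small degree, so the acyclic set is light.
\<close>

lemma exists_orientation_light_acyclic_sets:
  fixes G :: "'a pair_pre_digraph" and w :: "'a \<Rightarrow> real"
  assumes G: "pair_graph G" and w: "\<And>v. 0 \<le> w v" "(\<Sum>v\<in>pverts G. w v) = 1"
    and indep: "\<And>I. I \<in> independent_sets G \<Longrightarrow> (\<Sum>v\<in>I. w v) \<le> c"
    and d: "2 \<le> d" and \<beta>: "0 < \<beta>" and q: "exp 1 * ((real d + 1) / sqrt 2 ^ d) / \<beta> \<le> 1 / 4"
  obtains D where "D \<in> orientations G" "\<And>S. S \<in> acyclic_sets D \<Longrightarrow> (\<Sum>v\<in>S. w v) \<le> \<beta> + real d * c"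
proof -
  interpret pair_graph G by fact
  define V A g where "V = pverts G" and "A = parcs G" and "g = (real d + 1) / sqrt 2 ^ d"
  have V: "finite V" by (simp add: V_def)
  have A: "finite A" "sym A" "irrefl A"
    using pair_sym_arcs no_loops' by (auto simp: A_def symmetric_def irrefl_def)
  define dense where "dense = {R. top_heavy V w \<beta> R \<and> (\<forall>v\<in>R. d \<le> card {u \<in> R. (v, u) \<in> A})}"
  define bad where "bad = (\<lambda>R. {r \<in> orientations_of A. acyclic (r \<inter> R \<times> R)})"
  have finO: "finite (orientations_of A)" by (rule finite_orientations_of[OF A(1)])
  have pos: "0 < real (card (orientations_of A))"
    using card_orientations_of_ge[OF A] by (rule less_le_trans[rotated]) simp
  have subV: "{R. top_heavy V w \<beta> R} \<subseteq> Pow V" by (auto simp: top_heavy_def)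
  have finT: "finite {R. top_heavy V w \<beta> R}" using finite_subset[OF subV] V by simp
  then have finD: "finite dense" by (rule rev_finite_subset) (auto simp: dense_def)
  have "real (card (\<Union>R\<in>dense. bad R)) \<le> (\<Sum>R\<in>dense. real (card (bad R)))"
    using of_nat_mono[OF card_UN_le[OF finD, of bad], where ?'a = real] by simp
  also have "\<dots> \<le> (\<Sum>R\<in>dense. g ^ card R * real (card (orientations_of A)))"
  proof (rule sum_mono)
    fix R assume R: "R \<in> dense"
    then have "R \<subseteq> V" by (simp add: dense_def top_heavy_def)
    then have "finite R" using V by (rule finite_subset)
    then show "real (card (bad R)) \<le> g ^ card R * real (card (orientations_of A))"
      unfolding bad_def g_def using R
      by (intro card_orientations_of_acyclic_on_le_min_degree A d) (auto simp: dense_def)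
  qed
  also have "\<dots> = (\<Sum>R\<in>dense. g ^ card R) * real (card (orientations_of A))"
    by (simp add: sum_distrib_right)
  also have "\<dots> \<le> (\<Sum>R | top_heavy V w \<beta> R. g ^ card R) * real (card (orientations_of A))"
    using finT by (intro mult_right_mono sum_mono2) (auto simp: dense_def g_def)
  also have "\<dots> < 1 * real (card (orientations_of A))"
    using sum_top_heavy_less_one[OF V \<beta>, of g w] q pos by (intro mult_strict_right_mono) (auto simp: g_def)
  finally have less: "card (\<Union>R\<in>dense. bad R) < card (orientations_of A)" by simp
  have "\<not> orientations_of A \<subseteq> (\<Union>R\<in>dense. bad R)"
  proof
    assume "orientations_of A \<subseteq> (\<Union>R\<in>dense. bad R)"
    moreover have "finite (\<Union>R\<in>dense. bad R)" using finO finD by (auto simp: bad_def)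
    ultimately have "card (orientations_of A) \<le> card (\<Union>R\<in>dense. bad R)" by (intro card_mono)
    then show False using less by simp
  qed
  then obtain r where r: "r \<in> orientations_of A" "\<And>R. R \<in> dense \<Longrightarrow> \<not> acyclic (r \<inter> R \<times> R)"
    by (auto simp: bad_def)
  define D where "D = \<lparr>pverts = V, parcs = r\<rparr>"
  have "D \<in> orientations G"
    using r(1) by (simp add: orientations_eq_orientations_of D_def V_def A_def)
  moreover have "(\<Sum>v\<in>S. w v) \<le> \<beta> + real d * c" if S: "S \<in> acyclic_sets D" for S
  proof -
    have "r \<subseteq> A" using r(1) by (simp add: orientations_of_def)
    have "pair_wf_digraph D"
    proof unfold_locales
      fix e assume "e \<in> parcs D"
      then have "(fst e, snd e) \<in> parcs G" using \<open>r \<subseteq> A\<close> by (auto simp: D_def A_def)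
      from in_arcsD1[OF this] in_arcsD2[OF this]
      show "fst e \<in> pverts D" "snd e \<in> pverts D" by (simp_all add: D_def V_def)
    qed
    note acyc = acyclic_sets_imp_acyclic[OF this S]
    have "(\<Sum>v\<in>S. w v) \<le> \<beta> * (\<Sum>v\<in>V. w v) + real d * c"
    proof (rule weight_le_of_no_dense_top_heavy[OF V _ A(2,3)])
      show "S \<subseteq> V" using S by (simp add: acyclic_sets_def D_def)
      show "\<exists>v\<in>R. card {u \<in> R. (v, u) \<in> A} < d" if "R \<subseteq> S" "top_heavy V w \<beta> R" for R
      proof (rule ccontr)
        assume "\<not> (\<exists>v\<in>R. card {u \<in> R. (v, u) \<in> A} < d)"
        then have "R \<in> dense" using that by (auto simp: dense_def not_less)
        then show False using r(2) acyc[OF \<open>R \<subseteq> S\<close>] by (simp add: D_def)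
      qed
      show "(\<Sum>v\<in>I. w v) \<le> c" if "I \<subseteq> V" "\<forall>u\<in>I. \<forall>v\<in>I. (u, v) \<notin> A" for I
        using indep[of I] that by (simp add: independent_sets_def V_def A_def)
    qed (use w \<beta> in auto)
    then show ?thesis using w(2) by (simp add: V_def)
  qed
  ultimately show ?thesis using that by blast
qed


section \<open>Lower bounds on the fractional dichromatic number\<close>

lemma fractional_dichromatic_number_ge:
  assumes "pair_graph G" "D \<in> orientations G"
  shows "digraph_fractional_chromatic_number D \<le> fractional_dichromatic_number G"
  unfolding fractional_dichromatic_number_def
  using assms finite_orientations by (intro Max_ge) auto

lemma digraph_fractional_chromatic_number_ge_weight:
  assumes G: "pair_graph G" and D: "D \<in> orientations G"
    and w: "\<And>v. v \<in> pverts G \<Longrightarrow> 0 \<le> w v" and a: "0 < a"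
    and le: "\<And>S. S \<in> acyclic_sets D \<Longrightarrow> (\<Sum>v\<in>S. w v) \<le> a"
  shows "(\<Sum>v\<in>pverts G. w v) / a \<le> digraph_fractional_chromatic_number D"
proof -
  interpret pair_graph G by fact
  have V: "pverts D = pverts G" using D by (simp add: orientations_def)
  show ?thesis
    unfolding digraph_fractional_chromatic_number_def V[symmetric]
  proof (rule fractional_cover_number_ge_weight)
    show "pverts D \<subseteq> \<Union> (acyclic_sets D)" by (rule acyclic_sets_cover[OF G D])
    show "(\<Sum>v\<in>pverts D \<inter> S. w v) \<le> a" if "S \<in> acyclic_sets D" for S
      using le[OF that] that by (auto simp: acyclic_sets_def Int_absorb1)
  qed (use w a V in \<open>auto intro: finite_acyclic_sets\<close>)
qed

lemma fractional_dichromatic_number_nonneg: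
  assumes G: "pair_graph G"
  shows "0 \<le> fractional_dichromatic_number G"
proof -
  interpret pair_graph G by fact
  obtain D where D: "D \<in> orientations G" using orientations_nonempty[OF G] by blast
  have "0 \<le> digraph_fractional_chromatic_number D"
    using digraph_fractional_chromatic_number_ge_weight[OF G D, of "\<lambda>_. 0" 1] by simp
  then show ?thesis using fractional_dichromatic_number_ge[OF G D] by linarith
qed

text \<open>
Weak duality for the weighting that is concentrated on \<open>x\<close>.
\<close>

lemma fractional_dichromatic_number_ge_1:
  assumes G: "pair_graph G" and x: "x \<in> pverts G"
  shows "1 \<le> fractional_dichromatic_number G"
proof -
  interpret pair_graph G by fact
  obtain D where D: "D \<in> orientations G" using orientations_nonempty[OF G] by blast
  have V: "pverts D = pverts G" using D by (simp add: orientations_def)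
  have "(\<Sum>v\<in>S. if v = x then 1 else 0) \<le> (1 :: real)" if "S \<in> acyclic_sets D" for S
  proof -
    have "S \<subseteq> pverts G" using that V by (simp add: acyclic_sets_def)
    then have "finite S" by (rule finite_subset) simp
    then show ?thesis by simp
  qed
  then have "(\<Sum>v\<in>pverts G. if v = x then 1 else 0) / 1 \<le> digraph_fractional_chromatic_number D"
    by (intro digraph_fractional_chromatic_number_ge_weight[OF G D]) auto
  then show ?thesis using fractional_dichromatic_number_ge[OF G D] x by simp
qed


section \<open>Numerical estimates and the theorem\<close>

lemma exp_1_ge: "5 / 2 \<le> exp (1 :: real)"
  using exp_lower_Taylor_quadratic[of 1] by simp

text \<open>
The logarithm grows with \<open>\<bar>t\<bar>\<close>; at \<open>\<bar>t\<bar> = 1 / 2\<close> its argument is \<open>e / 2 > 5 / 4\<close>, and \<open>(5 / 4)\<^sup>4 > 2\<close>.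
\<close>

lemma log_bound_gt_quarter:
  fixes t :: real
  assumes "1 / 2 \<le> \<bar>t\<bar>"
  shows "1 / 4 < log 2 (2 * exp 1 * t\<^sup>2)"
proof -
  have "(1 / 2)\<^sup>2 \<le> t\<^sup>2" using power_mono[OF assms, of 2] by simp
  then have "2 * (5 / 2) * (1 / 4) \<le> 2 * exp 1 * t\<^sup>2"
    using exp_1_ge by (intro mult_mono) (auto simp: power2_eq_square)
  then have "log 2 (5 / 4) \<le> log 2 (2 * exp 1 * t\<^sup>2)" by (subst log_le_cancel_iff) auto
  moreover have "4 * log 2 (5 / 4) = log 2 ((5 / 4) ^ 4)" by (simp add: log_nat_power)
  moreover have "log 2 2 < log 2 ((5 / 4 :: real) ^ 4)" by (subst log_less_cancel_iff) (auto simp: power4_eq_xxxx)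
  moreover have "log 2 (2 :: real) = 1" by simp
  ultimately show ?thesis by linarith
qed

text \<open>
The bound of the theorem exceeds \<open>1\<close> only for large \<open>t\<close>. A lower bound \<open>2\<^sup>k\<close> on \<open>t\<close> gives
\<open>L \<ge> 2k + 2\<close>, hence \<open>t > 8k + 8\<close>; starting from \<open>k = 0\<close>, two rounds suffice.
\<close>

lemma nontrivial_range:
  fixes t :: real
  defines "L \<equiv> log 2 (2 * exp 1 * t\<^sup>2)"
  assumes t: "1 / 2 \<le> t" "4 * L < t"
  shows "8 \<le> L" "32 < t"
proof -
  have "1 / 4 < L" unfolding L_def using t(1) by (intro log_bound_gt_quarter) auto
  have grow: "2 * real k + 2 \<le> L" if "2 ^ k \<le> t" for k
  proof -
    have "4 * (2 ^ k)\<^sup>2 \<le> 2 * exp 1 * t\<^sup>2"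
      using that exp_1_ge by (intro mult_mono power_mono) auto
    then have "2 ^ (2 * k + 2) \<le> 2 * exp 1 * t\<^sup>2"
      by (simp add: power_add power_mult power2_eq_square power_mult_distrib[symmetric])
    then have "log 2 (2 ^ (2 * k + 2)) \<le> L" unfolding L_def by (intro log_mono) auto
    moreover have "log 2 (2 ^ (2 * k + 2)) = real (2 * k + 2)" by (rule log_pow_cancel) auto
    ultimately show ?thesis by linarith
  qed
  have "1 \<le> t" using \<open>1 / 4 < L\<close> t by simp
  then have "2 \<le> L" using grow[of 0] by simp
  then have "2 ^ 3 \<le> t" using t by simp
  then show "8 \<le> L" using grow[of 3] by simp
  then show "32 < t" using t by simp
qed

text \<open>
The choice \<open>d \<ge> 2L\<close> makes \<open>\<surd>2\<^bsup>d\<^esup>\<close> at least \<open>2\<^bsup>L\<^esup> = 2et\<^sup>2\<close>. One factor \<open>t\<close> of this pays for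
\<open>1 / \<beta> = 2t / (3L)\<close>; the other leaves the margin.
\<close>

lemma union_bound_parameter:
  fixes t L :: real
  assumes L: "L = log 2 (2 * exp 1 * t\<^sup>2)" and big: "8 \<le> L" "32 < t"
    and d: "2 * L \<le> real d" "real d \<le> 2 * L + 1"
  shows "exp 1 * ((real d + 1) / sqrt 2 ^ d) / (3 * L / (2 * t)) \<le> 1 / 4"
proof -
  have "2 * exp 1 * t\<^sup>2 = 2 powr L" using big by (simp add: L)
  also have "\<dots> = sqrt 2 powr (2 * L)" by (simp add: powr_half_sqrt[symmetric] powr_powr)
  also have "\<dots> \<le> sqrt 2 powr real d" using d by (intro powr_mono) auto
  also have "\<dots> = sqrt 2 ^ d" by (simp add: powr_realpow)
  finally have pow: "2 * exp 1 * t\<^sup>2 \<le> sqrt 2 ^ d" .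
  have "(real d + 1) / sqrt 2 ^ d \<le> (2 * L + 2) / (2 * exp 1 * t\<^sup>2)"
    using pow d big by (intro frac_le) auto
  then have "exp 1 * ((real d + 1) / sqrt 2 ^ d) / (3 * L / (2 * t))
      \<le> exp 1 * ((2 * L + 2) / (2 * exp 1 * t\<^sup>2)) / (3 * L / (2 * t))"
    using big by (intro divide_right_mono mult_left_mono) auto
  also have "\<dots> = 2 * (L + 1) / (3 * (L * t))"
    using big by (simp add: field_simps power2_eq_square)
  also have "\<dots> \<le> 1 / 4"
  proof -
    have "8 * (L + 1) \<le> 3 * x" if "32 * L \<le> x" for x using that big by simp
    moreover have "32 * L \<le> L * t" using big by simp
    ultimately have "8 * (L + 1) \<le> 3 * (L * t)" by blast
    then show ?thesis using big by (simp add: divide_le_eq)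
  qed
  finally show ?thesis .
qed

theorem theorem1p3:
  fixes G :: "'a pair_pre_digraph" and t :: real
  assumes "pair_graph G"
    and "1 / 2 \<le> \<bar>t\<bar>"
    and "fractional_chromatic_number G \<ge> t"
  shows "fractional_dichromatic_number G \<ge> t / (4 * log 2 (2 * exp 1 * t\<^sup>2))"
proof -
  interpret pair_graph G by fact
  define L where "L = log 2 (2 * exp 1 * t\<^sup>2)"
  have "0 < L" using log_bound_gt_quarter[OF assms(2)] by (simp add: L_def)
  have fin: "finite (independent_sets G)" by (intro finite_independent_sets) simp
  have "t / (4 * L) \<le> fractional_dichromatic_number G"
  proof (cases "t \<le> 0")
    case True
    then have "t / (4 * L) \<le> 0" using \<open>0 < L\<close> by (simp add: divide_nonpos_pos)
    then show ?thesis using fractional_dichromatic_number_nonneg[OF assms(1)] by linarith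
  next
    case False
    then have t: "1 / 2 \<le> t" using assms(2) by simp
    have "pverts G \<noteq> {}"
      using assms(3) t fractional_cover_number_empty[OF fin]
      by (auto simp: fractional_chromatic_number_def)
    then have one: "1 \<le> fractional_dichromatic_number G"
      using fractional_dichromatic_number_ge_1[OF assms(1)] by blast
    show ?thesis
    proof (cases "t \<le> 4 * L")
      case True
      then have "t / (4 * L) \<le> 1" using \<open>0 < L\<close> by simp
      then show ?thesis using one by linarith
    next
      case False
      then have big: "8 \<le> L" "32 < t" using nontrivial_range[of t] t by (auto simp: L_def)
      \<comment> \<open>The weight \<open>4L / t\<close> allowed to an acyclic set is split into a part \<open>d c\<close> with \<open>d\<close> about \<open>2L\<close>
        and \<open>c\<close> slightly above \<open>1 / t\<close>, for the \<open>d\<close> independent sets, and a part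
        \<open>\<beta> = 3L / (2t)\<close>; the factor \<open>11 / 10\<close> in \<open>c\<close> covers the loss in the duality.\<close>
      define c d where "c = 11 / (10 * t)" and "d = nat \<lceil>2 * L\<rceil>"
      have d: "2 * L \<le> real d" "real d \<le> 2 * L + 1" using big by (simp_all add: d_def)
      have "1 < c * t" using big by (simp add: c_def)
      also have "\<dots> \<le> c * fractional_chromatic_number G"
        using assms(3) big by (intro mult_left_mono) (auto simp: c_def)
      finally have "1 < c * fractional_cover_number (pverts G) (independent_sets G)"
        by (simp add: fractional_chromatic_number_def)
      then obtain w where w: "\<And>v. 0 \<le> w v" "(\<Sum>v\<in>pverts G. w v) = 1"
        and indep: "\<And>I. I \<in> independent_sets G \<Longrightarrow> (\<Sum>v\<in>pverts G \<inter> I. w v) \<le> c"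
        by (rule fractional_cover_dual[OF pair_finite_verts fin independent_sets_cover[OF assms(1)]]) blast
      have indep': "(\<Sum>v\<in>I. w v) \<le> c" if "I \<in> independent_sets G" for I
        using indep[OF that] that by (simp add: independent_sets_def Int_absorb1)
      obtain D where D: "D \<in> orientations G"
        and light: "\<And>S. S \<in> acyclic_sets D \<Longrightarrow> (\<Sum>v\<in>S. w v) \<le> 3 * L / (2 * t) + real d * c"
        using exists_orientation_light_acyclic_sets[OF assms(1) w indep' _ _
            union_bound_parameter[OF L_def big d]] d big by auto
      have "3 * L / (2 * t) + real d * c \<le> 3 * L / (2 * t) + (2 * L + 1) * c"
        using d big by (intro add_left_mono mult_right_mono) (auto simp: c_def)
      also have "\<dots> = (37 * L + 11) / (10 * t)" using big by (simp add: c_def field_simps)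
      also have "\<dots> \<le> 40 * L / (10 * t)" using big by (intro divide_right_mono) auto
      finally have "3 * L / (2 * t) + real d * c \<le> 4 * L / t" by simp
      then have "(\<Sum>v\<in>pverts G. w v) / (4 * L / t) \<le> digraph_fractional_chromatic_number D"
        using light w(1) big by (intro digraph_fractional_chromatic_number_ge_weight[OF assms(1) D]) (auto intro: order_trans)
      then show ?thesis using fractional_dichromatic_number_ge[OF assms(1) D] w(2) by simp
    qed
  qed
  then show ?thesis by (simp add: L_def)
qed

end
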